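(* Let $X$ be a real Banach space, let $\tau$ be either the norm topology or the weak topology of $X$, let $V$ be a $\tau$-closed subset of $X$, and let $\mathcal{A}$ be a family of nonempty finite subsets of $X$. Let $\mathscr{F}_{cm}$ denote the class of all convex monotone functions $f:\ell_\infty^+(F)\to[0,\infty)$, $F\in\mathcal{A}$. Then the triplet $(X,V,\mathcal{A})$ has $\tau$-$\mathscr{F}_{cm}$-SACP if and only if $(X,V,\mathcal{A})$ has the $\tau$-$\mathscr{F}_{cm}$-property-$(P_1)$ and $\mathrm{Cent}_V^f(F)$ is $\tau$-compact for every $F\in\mathcal{A}$ and every $f:\ell_\infty^+(F)\to[0,\infty)$ in $\mathscr{F}_{cm}$.
   Context: For a nonempty closed bounded set $F\subseteq X$, $\ell_\infty^+(F)$ is the set of bounded functions $\varphi:F\to[0,\infty)$, ordered coordinatewise ($\varphi_1\le\varphi_2$ iff $\varphi_1(t)\le\varphi_2(t)$ for all $t\in F$); for finite $F$ this is identified with $[0,\infty)^{card(F)}$. A function $f:\ell_\infty^+(F)\to[0,\infty)$ is monotone if $\varphi_1\le\varphi_2$ implies $f(\varphi_1)\le f(\varphi_2)$. For $x\in X$ and $V\subseteq X$: $r_f(x,F)=f((\|x-a\|)_{a\in F})$, $\mathrm{rad}_V^f(F)=\inf_{v\in V}r_f(v,F)$, $\mathrm{Cent}_V^f(F)=\{v\in V: r_f(v,F)=\mathrm{rad}_V^f(F)\}$, and for $\delta>0$, $\delta\text{-}\mathrm{Cent}_V^f(F)=\{v\in V: r_f(v,F)\le \mathrm{rad}_V^f(F)+\delta\}$.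 For a family $\mathfrak{F}$ of such sets and a class $\mathscr{F}$ of such functions: $(X,V,\mathfrak{F})$ has $\tau$-$\mathscr{F}$-property-$(P_1)$ if for all $F\in\mathfrak{F}$ and all $f\in\mathscr{F}$ defined on $\ell_\infty^+(F)$, $\mathrm{Cent}_V^f(F)\neq\emptyset$ and for every $\tau$-neighbourhood $W$ of $0$ there is $\delta>0$ with $\delta\text{-}\mathrm{Cent}_V^f(F)\subseteq \mathrm{Cent}_V^f(F)+W$. $(X,V,\mathfrak{F})$ has $\tau$-$\mathscr{F}$-SACP if for all $F\in\mathfrak{F}$, all $f\in\mathscr{F}$ defined on $\ell_\infty^+(F)$ and every sequence $(v_n)\subseteq V$ with $r_f(v_n,F)\to\mathrm{rad}_V^f(F)$, the sequence $(v_n)$ has a $\tau$-convergent subsequence. *)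

theory Defs
  imports "HOL-Analysis.Analysis"
begin

definition weak_topology :: "'a::real_normed_vector topology" where
  "weak_topology = topology_generated_by
     {{x. f x \<in> U} | (f :: 'a \<Rightarrow> real) U. bounded_linear f \<and> open U}"

text \<open>The positive cone of bounded functions on a finite set F (functions vanishing off F).
For finite F every function is bounded.\<close>
definition linf_pos :: "'a set \<Rightarrow> ('a \<Rightarrow> real) set" where
  "linf_pos F = {\<phi>. (\<forall>t\<in>F. 0 \<le> \<phi> t) \<and> (\<forall>t. t \<notin> F \<longrightarrow> \<phi> t = 0)}"

definition convex_monotone_fun :: "'a set \<Rightarrow> (('a \<Rightarrow> real) \<Rightarrow> real) \<Rightarrow> bool" where
  "convex_monotone_fun F f \<longleftrightarrow>
     (\<forall>\<phi>\<in>linf_pos F. 0 \<le> f \<phi>) \<and>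
     (\<forall>\<phi>1\<in>linf_pos F. \<forall>\<phi>2\<in>linf_pos F. (\<forall>t\<in>F. \<phi>1 t \<le> \<phi>2 t) \<longrightarrow> f \<phi>1 \<le> f \<phi>2) \<and>
     (\<forall>\<phi>1\<in>linf_pos F. \<forall>\<phi>2\<in>linf_pos F. \<forall>u::real. 0 \<le> u \<and> u \<le> 1 \<longrightarrow>
        f (\<lambda>t. u * \<phi>1 t + (1 - u) * \<phi>2 t) \<le> u * f \<phi>1 + (1 - u) * f \<phi>2)"

definition r_f :: "(('a \<Rightarrow> real) \<Rightarrow> real) \<Rightarrow> 'a::real_normed_vector \<Rightarrow> 'a set \<Rightarrow> real" where
  "r_f f x F = f (\<lambda>a. if a \<in> F then norm (x - a) else 0)"

definition rad :: "'a::real_normed_vector set \<Rightarrow> (('a \<Rightarrow> real) \<Rightarrow> real) \<Rightarrow> 'a set \<Rightarrow> real" where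
  "rad V f F = Inf ((\<lambda>v. r_f f v F) ` V)"

definition Cent :: "'a::real_normed_vector set \<Rightarrow> (('a \<Rightarrow> real) \<Rightarrow> real) \<Rightarrow> 'a set \<Rightarrow> 'a set" where
  "Cent V f F = {v \<in> V. r_f f v F = rad V f F}"

definition delta_Cent :: "real \<Rightarrow> 'a::real_normed_vector set \<Rightarrow> (('a \<Rightarrow> real) \<Rightarrow> real) \<Rightarrow> 'a set \<Rightarrow> 'a set" where
  "delta_Cent \<delta> V f F = {v \<in> V. r_f f v F \<le> rad V f F + \<delta>}"

definition property_P1 :: "'a::real_normed_vector topology \<Rightarrow> 'a set \<Rightarrow> 'a set set \<Rightarrow> bool" where
  "property_P1 \<tau> V \<A> \<longleftrightarrow>
     (\<forall>F\<in>\<A>. \<forall>f. convex_monotone_fun F f \<longrightarrow>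
        Cent V f F \<noteq> {} \<and>
        (\<forall>W. (\<exists>U. openin \<tau> U \<and> 0 \<in> U \<and> U \<subseteq> W) \<longrightarrow>
           (\<exists>\<delta>>0. delta_Cent \<delta> V f F \<subseteq> {c + w | c w. c \<in> Cent V f F \<and> w \<in> W})))"

definition SACP :: "'a::real_normed_vector topology \<Rightarrow> 'a set \<Rightarrow> 'a set set \<Rightarrow> bool" where
  "SACP \<tau> V \<A> \<longleftrightarrow>
     (\<forall>F\<in>\<A>. \<forall>f. convex_monotone_fun F f \<longrightarrow>
        (\<forall>v :: nat \<Rightarrow> 'a. (\<forall>n. v n \<in> V) \<and> (\<lambda>n. r_f f (v n) F) \<longlonglongrightarrow> rad V f F \<longrightarrow>
           (\<exists>r l. strict_mono r \<and> limitin \<tau> (v \<circ> r) l sequentially)))"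

end

(*
  For f = 0 every point of V is a center, so the compactness of the centers makes V tau-compact; by the
  Eberlein-Smulian theorem V is then tau-sequentially compact, which gives SACP at once. Conversely, under
  SACP each minimizing sequence has a subsequence converging to a center, because r_f is weakly
  sequentially lower semicontinuous: the norm is, and a convex monotone f satisfies
  f ((1 - s) phi) >= (1 + s) f phi - s f (2 phi), hence is lower semicontinuous along rays at phi.
  So the centers exist and form a sequentially compact set, which is compact by Eberlein-Smulian, and
  a failure of (P1) would produce a minimizing sequence staying away from the centers.
*)
theory Submission
  imports Defs
begin

section \<open>The Hahn-Banach theorem\<close>

text \<open>Two obstacles shape the argument. Weak convergence controls the distances
  \<open>norm (v n - a)\<close> only from below, and \<open>f\<close> is not assumed continuous up
  to the boundary of the cone; convexity alone would allow a jump there (value 1 at 0 and 0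
  elsewhere on the half-line). Hence the distance vector of the limit is shrunk by a factor
  \<open>1 - s\<close>, which keeps it in the cone and leaves vanishing coordinates at zero, and
  monotonicity transfers the eventual domination to \<open>f\<close>. The weak topology is in
  general not metrizable, so open covers and subsequences have to be linked by Eberlein-Smulian. Its
  proof embeds the space into the real functions on the dual with pointwise convergence; countably
  many coordinates give a metrizable space, where subsequences exist. Hahn-Banach supplies norming
  functionals and separation from closed subspaces. It is obtained from minimal sublinear
  functionals, so that Zorn's lemma ranges over total functions instead of partial
  extensions.\<close>

definition sublinear :: "('a::real_vector \<Rightarrow> real) \<Rightarrow> bool" where
  "sublinear p \<longleftrightarrow> (\<forall>x y. p (x + y) \<le> p x + p y) \<and> (\<forall>x t. 0 \<le> t \<longrightarrow> p (t *\<^sub>R x) = t * p x)"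

lemma sublinear_add: "sublinear p \<Longrightarrow> p (x + y) \<le> p x + p y"
  and sublinear_scale: "sublinear p \<Longrightarrow> 0 \<le> t \<Longrightarrow> p (t *\<^sub>R x) = t * p x"
  by (auto simp: sublinear_def)

lemma sublinear_zero: "sublinear p \<Longrightarrow> p 0 = 0"
  using sublinear_scale[of p 0 0] by simp

lemma sublinear_minus: "sublinear p \<Longrightarrow> - p (- x) \<le> p x"
  using sublinear_add[of p x "- x"] sublinear_zero[of p] by simp

lemma sublinear_lower_bound:
  assumes "sublinear p" "\<And>x. p x \<le> q x"
  shows "- q (- x) \<le> p x"
  using sublinear_minus[OF assms(1), of x] assms(2)[of "- x"] by linarith

text \<open>Every member lies above \<open>- q (- x)\<close>, so the infima are finite. The chain
  condition serves subadditivity: of two members, the smaller one alone bounds both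
  summands.\<close>

lemma sublinear_Inf_chain:
  fixes C :: "('a::real_vector \<Rightarrow> real) set"
  assumes "C \<noteq> {}" and sub: "\<And>p. p \<in> C \<Longrightarrow> sublinear p \<and> p \<le> q"
    and chain: "\<And>p p'. p \<in> C \<Longrightarrow> p' \<in> C \<Longrightarrow> p \<le> p' \<or> p' \<le> p"
  shows "sublinear (\<lambda>x. INF p\<in>C. p x)" and "\<And>p x. p \<in> C \<Longrightarrow> (INF p\<in>C. p x) \<le> p x"
proof -
  have bdd: "bdd_below ((\<lambda>p. p x) ` C)" for x
    using sublinear_lower_bound[of _ q x] sub by (intro bdd_belowI2[of _ "- q (- x)"]) (auto simp: le_fun_def)
  show low: "(INF p\<in>C. p x) \<le> p x" if "p \<in> C" for p x
    by (rule cINF_lower[OF bdd that])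
  have add: "(INF p\<in>C. p (x + y)) \<le> (INF p\<in>C. p x) + (INF p\<in>C. p y)" for x y
  proof -
    have "(INF p\<in>C. p (x + y)) \<le> p x + p' y" if "p \<in> C" "p' \<in> C" for p p'
      using chain[OF that]
    proof
      assume "p \<le> p'"
      then have "p y \<le> p' y" by (auto simp: le_fun_def)
      with low[OF that(1), of "x + y"] sublinear_add[of p x y] sub[OF that(1)] show ?thesis by linarith
    next
      assume "p' \<le> p"
      then have "p' x \<le> p x" by (auto simp: le_fun_def)
      with low[OF that(2), of "x + y"] sublinear_add[of p' x y] sub[OF that(2)] show ?thesis by linarith
    qed
    then have "(INF p\<in>C. p (x + y)) - p x \<le> (INF p\<in>C. p y)" if "p \<in> C" for p
      by (intro cINF_greatest[OF assms(1)]) (use that in \<open>simp add: diff_le_eq add.commute[of "_ y"]\<close>)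
    then have "(INF p\<in>C. p (x + y)) - (INF p\<in>C. p y) \<le> (INF p\<in>C. p x)"
      by (intro cINF_greatest[OF assms(1)]) (simp add: diff_le_eq add.commute)
    then show ?thesis by linarith
  qed
  have scale_le: "t * (INF p\<in>C. p x) \<le> (INF p\<in>C. p (t *\<^sub>R x))" if "0 \<le> t" for t x
  proof (rule cINF_greatest[OF assms(1)])
    fix p assume p: "p \<in> C"
    with sub sublinear_scale[of p t x] that have "p (t *\<^sub>R x) = t * p x" by blast
    then show "t * (INF p\<in>C. p x) \<le> p (t *\<^sub>R x)"
      using mult_left_mono[OF low[OF p] that] by simp
  qed
  have scale: "(INF p\<in>C. p (t *\<^sub>R x)) = t * (INF p\<in>C. p x)" if t: "0 \<le> t" for t x
  proof (cases "t = 0")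
    case True
    have "(INF p\<in>C. p 0) = (INF p\<in>C. 0)"
      using sub sublinear_zero by (intro INF_cong) auto
    with True assms(1) show ?thesis by simp
  next
    case False
    have "inverse t * (INF p\<in>C. p (t *\<^sub>R x)) \<le> (INF p\<in>C. p x)"
      using scale_le[of "inverse t" "t *\<^sub>R x"] False t by simp
    then have "(INF p\<in>C. p (t *\<^sub>R x)) \<le> t * (INF p\<in>C. p x)"
      using False t by (simp add: field_simps)
    with scale_le[OF t, of x] show ?thesis by linarith
  qed
  show "sublinear (\<lambda>x. INF p\<in>C. p x)"
    using add scale by (simp add: sublinear_def)
qed

lemma minimal_sublinear:
  fixes p :: "'a::real_vector \<Rightarrow> real"
  assumes "sublinear p"
  obtains m where "sublinear m" "m \<le> p" "\<And>q. sublinear q \<Longrightarrow> q \<le> m \<Longrightarrow> q = m"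
proof -
  let ?A = "{q. sublinear q \<and> q \<le> p}"
  have "\<exists>m\<in>?A. \<forall>q\<in>?A. q \<le> m \<longrightarrow> q = m"
  \<comment> \<open>Zorn's lemma produces maximal elements, so the order is reversed.\<close>
  proof (rule predicate_Zorn[where P = "\<lambda>x y. y \<le> x"])
    show "partial_order_on ?A (relation_of (\<lambda>x y. y \<le> x) ?A)"
      by (rule partial_order_on_relation_ofI) auto
    fix C assume C: "C \<in> Chains (relation_of (\<lambda>x y. y \<le> x) ?A)"
    show "\<exists>u\<in>?A. \<forall>a\<in>C. u \<le> a"
    proof (cases "C = {}")
      case True
      then show ?thesis using assms by auto
    next
      case False
      have sub: "\<And>q. q \<in> C \<Longrightarrow> sublinear q \<and> q \<le> p"
        and ch: "\<And>q q'. q \<in> C \<Longrightarrow> q' \<in> C \<Longrightarrow> q \<le> q' \<or> q' \<le> q"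
        using C by (auto simp: Chains_def relation_of_def)
      have inf: "sublinear (\<lambda>x. INF q\<in>C. q x)" "(INF q\<in>C. q x) \<le> q x" if "q \<in> C" for q x
        by (rule sublinear_Inf_chain[of C p]; use False sub ch that in blast)+
      obtain q where q: "q \<in> C" using False by auto
      have "(\<lambda>x. INF q\<in>C. q x) \<le> p"
        using inf(2)[OF q] sub[OF q] by (auto simp: le_fun_def intro: order_trans)
      then show ?thesis
        using inf(1)[OF q] inf(2) by (intro bexI[of _ "\<lambda>x. INF q\<in>C. q x"]) (auto simp: le_fun_def)
    qed
  qed
  then show ?thesis using that by (auto intro: order_trans)
qed

text \<open>The parameter \<open>t = 0\<close> gives \<open>q \<le> p\<close>, and
  \<open>t = 1\<close> at \<open>- y\<close> gives \<open>q (- y) \<le> - p y\<close>: passing from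
  \<open>p\<close> to \<open>q\<close> forces linearity along \<open>y\<close>. The infimum is
  finite because \<open>t * p y \<le> p (x + t *\<^sub>R y) + p (- x)\<close>.\<close>

lemma sublinear_directional:
  fixes p :: "'a::real_vector \<Rightarrow> real" and y :: 'a
  assumes p: "sublinear p"
  defines "q \<equiv> \<lambda>x. INF t\<in>{0..}. p (x + t *\<^sub>R y) - t * p y"
  shows "sublinear q" "\<And>t x. 0 \<le> t \<Longrightarrow> q x \<le> p (x + t *\<^sub>R y) - t * p y"
proof -
  have bdd: "bdd_below ((\<lambda>t. p (x + t *\<^sub>R y) - t * p y) ` {0..})" for x
  proof (intro bdd_belowI2)
    fix t :: real assume t: "t \<in> {0..}"
    have "t * p y \<le> p (x + t *\<^sub>R y) + p (- x)"
      using sublinear_add[OF p, of "x + t *\<^sub>R y" "- x"] sublinear_scale[OF p, of t y] t by simp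
    then show "- p (- x) \<le> p (x + t *\<^sub>R y) - t * p y" by simp
  qed
  show low: "q x \<le> p (x + t *\<^sub>R y) - t * p y" if "0 \<le> t" for t x
    unfolding q_def using cINF_lower[OF bdd, of t x] that by simp
  have greatest: "c \<le> q x" if "\<And>t. 0 \<le> t \<Longrightarrow> c \<le> p (x + t *\<^sub>R y) - t * p y" for c x
    unfolding q_def using that by (intro cINF_greatest) auto
  have add: "q (x + z) \<le> q x + q z" for x z
  proof -
    \<comment> \<open>The parameters of the two summands add up: \<open>s + t\<close> is admissible
      for \<open>x + z\<close>.\<close>
    have "q (x + z) \<le> (p (x + s *\<^sub>R y) - s * p y) + (p (z + t *\<^sub>R y) - t * p y)"
      if "0 \<le> s" "0 \<le> t" for s t
      using low[of "s + t" "x + z"] sublinear_add[OF p, of "x + s *\<^sub>R y" "z + t *\<^sub>R y"] that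
      by (simp add: algebra_simps)
    then have "q (x + z) - (p (x + s *\<^sub>R y) - s * p y) \<le> q z" if "0 \<le> s" for s
      by (intro greatest) (use that in \<open>simp add: diff_le_eq add.commute\<close>)
    then have "q (x + z) - q z \<le> q x"
      by (intro greatest) (simp add: diff_le_eq add.commute)
    then show ?thesis by linarith
  qed
  have scale_le: "q (t *\<^sub>R x) \<le> t * q x" if t: "0 < t" for t x
  proof -
    have "inverse t * q (t *\<^sub>R x) \<le> p (x + s *\<^sub>R y) - s * p y" if "0 \<le> s" for s
    proof -
      have "q (t *\<^sub>R x) \<le> t * (p (x + s *\<^sub>R y) - s * p y)"
        using low[of "t * s" "t *\<^sub>R x"] sublinear_scale[OF p, of t "x + s *\<^sub>R y"] t that
        by (simp add: algebra_simps)
      then show ?thesis using t by (simp add: field_simps)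
    qed
    then have "inverse t * q (t *\<^sub>R x) \<le> q x"
      by (rule greatest)
    then show ?thesis using t by (simp add: field_simps)
  qed
  have "q 0 = 0"
  proof (rule antisym)
    show "q 0 \<le> 0" using low[of 0 0] sublinear_zero[OF p] by simp
    show "0 \<le> q 0"
      by (rule greatest) (simp add: sublinear_scale[OF p])
  qed
  moreover have "q (t *\<^sub>R x) = t * q x" if t: "0 < t" for t x
    using scale_le[OF t, of x] scale_le[of "inverse t" "t *\<^sub>R x"] t by (simp add: field_simps)
  ultimately have "q (t *\<^sub>R x) = t * q x" if "0 \<le> t" for t x
    using that by (cases "t = 0") auto
  with add show "sublinear q" by (simp add: sublinear_def)
qed

text \<open>By minimality, \<open>m\<close> equals its own directional functional for every
  \<open>y\<close>; the parameter \<open>t = 1\<close> is then the missing inequality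
  \<open>m x + m y \<le> m (x + y)\<close>.\<close>

lemma minimal_sublinear_linear:
  assumes m: "sublinear m" and min: "\<And>q. sublinear q \<Longrightarrow> q \<le> m \<Longrightarrow> q = m"
  shows "linear m"
proof -
  have add: "m (x + y) = m x + m y" for x y
  proof -
    define q where "q = (\<lambda>x. INF t\<in>{0..}. m (x + t *\<^sub>R y) - t * m y)"
    have q: "sublinear q" "0 \<le> t \<Longrightarrow> q x \<le> m (x + t *\<^sub>R y) - t * m y" for t x
      unfolding q_def by (rule sublinear_directional[OF m]; assumption)+
    have "q \<le> m"
      using q(2)[of 0] by (auto simp: le_fun_def)
    then have "q = m" by (rule min[OF q(1)])
    then have "m x \<le> m (x + y) - m y"
      using q(2)[of 1 x] by simp
    with sublinear_add[OF m, of x y] show ?thesis by linarith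
  qed
  have neg: "m (- x) = - m x" for x
    using add[of x "- x"] sublinear_zero[OF m] by simp
  have "m (r *\<^sub>R x) = r * m x" for r x
    using sublinear_scale[OF m, of r x] sublinear_scale[OF m, of "- r" x] neg[of "r *\<^sub>R x"]
    by (cases "0 \<le> r") auto
  with add show ?thesis by (intro linearI) auto
qed

theorem Hahn_Banach_dominated:
  fixes p :: "'a::real_vector \<Rightarrow> real"
  assumes p: "sublinear p"
  obtains f where "linear f" "f \<le> p" "f x = p x"
proof -
  define q where "q = (\<lambda>z. INF t\<in>{0..}. p (z + t *\<^sub>R x) - t * p x)"
  have dir: "sublinear q" "0 \<le> t \<Longrightarrow> q z \<le> p (z + t *\<^sub>R x) - t * p x" for t z
    unfolding q_def by (rule sublinear_directional[OF p]; assumption)+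
  \<comment> \<open>Minimality below \<open>q\<close> instead of \<open>p\<close> yields the
    equality at \<open>x\<close>: the parameter \<open>t = 1\<close> gives
    \<open>f (- x) \<le> - p x\<close>.\<close>
  obtain f where f: "sublinear f" "f \<le> q" and min: "\<And>q. sublinear q \<Longrightarrow> q \<le> f \<Longrightarrow> q = f"
    using minimal_sublinear[OF dir(1)] by blast
  have lin: "linear f" by (rule minimal_sublinear_linear[OF f(1) min])
  have fp: "f \<le> p"
    using order_trans[OF le_funD[OF f(2)] dir(2)[of 0]] by (simp add: le_fun_def)
  have "f (- x) \<le> - p x"
    using order_trans[OF le_funD[OF f(2)] dir(2)[of 1 "- x"]] sublinear_zero[OF p] by simp
  then have "p x \<le> f x" using linear_neg[OF lin, of x] by simp
  moreover have "f x \<le> p x" using fp by (auto simp: le_fun_def)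
  ultimately show ?thesis using that[OF lin fp] by linarith
qed

section \<open>Bounded functionals on normed spaces\<close>

lemma linear_le_norm_imp_blinfun:
  fixes f :: "'a::real_normed_vector \<Rightarrow> real"
  assumes "linear f" "\<And>x. f x \<le> norm x"
  obtains g :: "'a \<Rightarrow>\<^sub>L real" where "blinfun_apply g = f" "norm g \<le> 1"
proof -
  have b: "norm (f x) \<le> norm x" for x
    using assms(2)[of x] assms(2)[of "- x"] linear_neg[OF assms(1), of x] by (simp add: abs_le_iff)
  have bl: "bounded_linear f"
    using b by (intro bounded_linear_intro[of f 1]) (auto simp: linear_add[OF assms(1)] linear_scale[OF assms(1)])
  show ?thesis
  proof
    show "blinfun_apply (Blinfun f) = f" by (rule bounded_linear_Blinfun_apply[OF bl])
    then show "norm (Blinfun f) \<le> 1" by (intro norm_blinfun_bound) (use b in auto)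
  qed
qed

lemma norming_functional:
  fixes x :: "'a::real_normed_vector"
  obtains g :: "'a \<Rightarrow>\<^sub>L real" where "norm g \<le> 1" "blinfun_apply g x = norm x"
proof -
  have "sublinear (norm :: 'a \<Rightarrow> real)" by (auto simp: sublinear_def norm_triangle_ineq)
  from Hahn_Banach_dominated[OF this, of x] obtain f where f: "linear f" "f \<le> norm" "f x = norm x" .
  then have "\<And>x. f x \<le> norm x" by (auto simp: le_fun_def)
  from linear_le_norm_imp_blinfun[OF f(1) this] that f(3) show ?thesis by metis
qed

lemma infdist_subspace_sublinear:
  fixes Y :: "'a::real_normed_vector set"
  assumes Y: "subspace Y"
  shows "sublinear (\<lambda>x. infdist x Y)"
proof -
  have ne: "Y \<noteq> {}" using subspace_0[OF Y] by auto
  have inf: "infdist x Y = (INF a\<in>Y. norm (x - a))" for x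
    using ne by (simp add: infdist_notempty dist_norm)
  have le: "infdist x Y \<le> norm (x - a)" if "a \<in> Y" for x a
    using infdist_le[OF that, of x] by (simp add: dist_norm)
  have add: "infdist (x + y) Y \<le> infdist x Y + infdist y Y" for x y
  proof -
    have "infdist (x + y) Y \<le> norm (x - a) + norm (y - b)" if "a \<in> Y" "b \<in> Y" for a b
      using le[OF subspace_add[OF Y that], of "x + y"] norm_triangle_ineq[of "x - a" "y - b"]
      by (simp add: algebra_simps)
    then have "infdist (x + y) Y - norm (x - a) \<le> infdist y Y" if "a \<in> Y" for a
      unfolding inf[of y] by (intro cINF_greatest[OF ne]) (use that in \<open>simp add: diff_le_eq add.commute\<close>)
    then have "infdist (x + y) Y - infdist y Y \<le> infdist x Y"
      unfolding inf[of x] by (intro cINF_greatest[OF ne]) (simp add: diff_le_eq add.commute)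
    then show ?thesis by linarith
  qed
  have scale_le: "infdist (t *\<^sub>R x) Y \<le> t * infdist x Y" if t: "0 < t" for t x
  proof -
    have "inverse t * infdist (t *\<^sub>R x) Y \<le> norm (x - a)" if "a \<in> Y" for a
    proof -
      have "infdist (t *\<^sub>R x) Y \<le> t * norm (x - a)"
        using le[OF subspace_scale[OF Y that, of t], of "t *\<^sub>R x"] t
        by (simp flip: scaleR_diff_right)
      then show ?thesis using t by (simp add: field_simps)
    qed
    then have "inverse t * infdist (t *\<^sub>R x) Y \<le> infdist x Y"
      using ne unfolding inf[of x] by (intro cINF_greatest) auto
    then show ?thesis using t by (simp add: field_simps)
  qed
  have "infdist (t *\<^sub>R x) Y = t * infdist x Y" if t: "0 \<le> t" for t x
  proof (cases "t = 0")
    case True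
    then show ?thesis using subspace_0[OF Y] by simp
  next
    case False
    then show ?thesis
      using scale_le[of t x] scale_le[of "inverse t" "t *\<^sub>R x"] t by (simp add: field_simps)
  qed
  with add show ?thesis by (simp add: sublinear_def)
qed

text \<open>Domination by the distance to \<open>Y\<close> makes the functional nonpositive on
  \<open>Y\<close>, and replacing \<open>y\<close> by \<open>- y\<close> makes it zero; at
  \<open>x\<close> it equals the distance, which is positive because \<open>Y\<close> is
  closed.\<close>

lemma separating_functional:
  fixes Y :: "'a::real_normed_vector set"
  assumes Y: "subspace Y" "closed Y" and x: "x \<notin> Y"
  obtains g :: "'a \<Rightarrow>\<^sub>L real" where "\<And>y. y \<in> Y \<Longrightarrow> blinfun_apply g y = 0" "blinfun_apply g x \<noteq> 0"
proof -
  have ne: "Y \<noteq> {}" using subspace_0[OF Y(1)] by auto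
  from Hahn_Banach_dominated[OF infdist_subspace_sublinear[OF Y(1)], of x]
  obtain f where f: "linear f" "f \<le> (\<lambda>x. infdist x Y)" "f x = infdist x Y" .
  have "f z \<le> norm z" for z
    using f(2) infdist_le[OF subspace_0[OF Y(1)], of z] by (auto simp: le_fun_def intro: order_trans)
  from linear_le_norm_imp_blinfun[OF f(1) this] obtain g :: "'a \<Rightarrow>\<^sub>L real" where g: "blinfun_apply g = f" by metis
  have nonpos: "f y \<le> 0" if "y \<in> Y" for y
    using f(2) that by (metis infdist_zero le_fun_def)
  have "f y = 0" if "y \<in> Y" for y
    using nonpos[OF that] nonpos[OF subspace_neg[OF Y(1) that]] linear_neg[OF f(1), of y] by linarith
  moreover have "f x \<noteq> 0" using infdist_pos_not_in_closed[OF Y(2) ne x] f(3) by simp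
  ultimately show ?thesis using that g by metis
qed

section \<open>The Eberlein-Smulian theorem\<close>

lemma openin_weak_vimage:
  fixes g :: "'a::real_normed_vector \<Rightarrow>\<^sub>L real"
  shows "open U \<Longrightarrow> openin weak_topology (blinfun_apply g -` U)"
  unfolding weak_topology_def vimage_def
  by (rule topology_generated_by_Basis) (use blinfun.bounded_linear_right in blast)

lemma topspace_weak_topology [simp]: "topspace (weak_topology :: 'a::real_normed_vector topology) = UNIV"
  using openin_subset[OF openin_weak_vimage[OF open_UNIV, of "0 :: 'a \<Rightarrow>\<^sub>L real"]] by auto

lemma continuous_map_weak_blinfun:
  "continuous_map weak_topology euclideanreal (blinfun_apply g)"
  using openin_weak_vimage[of _ g] by (simp add: continuous_map_def vimage_def)

lemma continuous_map_into_function_space: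
  assumes "\<And>i. continuous_map X euclidean (\<lambda>x. f x i)"
  shows "continuous_map X euclidean f"
  using assms continuous_map_componentwise_UNIV[of X "\<lambda>_. euclidean" f]
  unfolding euclidean_product_topology by blast

text \<open>The canonical embedding into the bidual, with plain functions as values so that the
  target carries the product topology.\<close>

definition evaluation :: "'a::real_normed_vector \<Rightarrow> ('a \<Rightarrow>\<^sub>L real) \<Rightarrow> real" where
  "evaluation x = (\<lambda>g. blinfun_apply g x)"

text \<open>The generating sets are preimages of coordinate strips, and preimages commute with
  unions and finite intersections. Compactness and limits can thus be studied in a product of real
  lines.\<close>

lemma openin_weak_iff:
  "openin weak_topology W \<longleftrightarrow> (\<exists>U. open U \<and> W = evaluation -` U)"
proof
  assume "openin weak_topology W"
  then have "generate_topology_on {{x. f x \<in> U} | (f :: 'a \<Rightarrow> real) U. bounded_linear f \<and> open U} W"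
    unfolding weak_topology_def by (rule openin_topology_generated_by)
  then show "\<exists>U. open U \<and> W = evaluation -` U"
  proof (induction rule: generate_topology_on.induct)
    case Empty
    then show ?case by (intro exI[of _ "{}"]) auto
  next
    case (Int a b)
    then obtain U V where "open U" "a = evaluation -` U" "open V" "b = evaluation -` V" by auto
    then show ?case by (intro exI[of _ "U \<inter> V"]) auto
  next
    case (UN K)
    then obtain U where U: "\<And>k. k \<in> K \<Longrightarrow> open (U k) \<and> k = evaluation -` U k" by metis
    then have "open (\<Union>(U ` K))" "\<Union>K = evaluation -` \<Union>(U ` K)" by blast+
    then show ?case by blast
  next
    case (Basis s)
    then obtain f :: "'a \<Rightarrow> real" and U where f: "bounded_linear f" "open U" and s: "s = {x. f x \<in> U}"
      by auto
    have "open ((\<lambda>\<Lambda> :: ('a \<Rightarrow>\<^sub>L real) \<Rightarrow> real. \<Lambda> (Blinfun f)) -` U)"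
      using f(2) by (intro open_vimage continuous_on_product_coordinates)
    moreover have "s = evaluation -` ((\<lambda>\<Lambda> :: ('a \<Rightarrow>\<^sub>L real) \<Rightarrow> real. \<Lambda> (Blinfun f)) -` U)"
      using bounded_linear_Blinfun_apply[OF f(1)] by (auto simp: s evaluation_def)
    ultimately show ?case by blast
  qed
next
  have cont: "continuous_map weak_topology euclidean (evaluation :: 'a \<Rightarrow> _)"
    unfolding evaluation_def by (intro continuous_map_into_function_space continuous_map_weak_blinfun)
  assume "\<exists>U. open U \<and> W = evaluation -` U"
  then show "openin weak_topology W"
    using cont by (auto simp: continuous_map_def vimage_def)
qed

lemma compactin_weak_iff:
  fixes S :: "'a::real_normed_vector set"
  shows "compactin weak_topology S \<longleftrightarrow> compact (evaluation ` S)"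
proof
  have cont: "continuous_map weak_topology euclidean (evaluation :: 'a \<Rightarrow> _)"
    by (auto simp: continuous_map_def openin_weak_iff vimage_def)
  show "compactin weak_topology S \<Longrightarrow> compact (evaluation ` S)"
    using image_compactin[OF _ cont] by simp
next
  assume comp: "compact (evaluation ` S)"
  show "compactin weak_topology S"
    unfolding compactin_def
  proof (intro conjI allI impI)
    fix \<U> assume \<U>: "(\<forall>U\<in>\<U>. openin weak_topology U) \<and> S \<subseteq> \<Union>\<U>"
    then have "\<forall>W\<in>\<U>. \<exists>U. open U \<and> W = evaluation -` U" by (simp add: openin_weak_iff)
    then obtain U where U: "\<And>W. W \<in> \<U> \<Longrightarrow> open (U W) \<and> W = evaluation -` U W" by metis
    have "evaluation ` S \<subseteq> \<Union>(U ` \<U>)" using \<U> U by blast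
    then obtain \<D> where "\<D> \<subseteq> \<U>" "finite \<D>" "evaluation ` S \<subseteq> \<Union>(U ` \<D>)"
      using compactE_image[OF comp, of \<U> U] U by metis
    moreover from this have "S \<subseteq> \<Union>\<D>"
      using U by blast
    ultimately show "\<exists>\<F>. finite \<F> \<and> \<F> \<subseteq> \<U> \<and> S \<subseteq> \<Union>\<F>" by blast
  qed simp
qed

lemma limitin_weak_iff:
  fixes v :: "'b \<Rightarrow> 'a::real_normed_vector"
  shows "limitin weak_topology v l F \<longleftrightarrow> (\<forall>g :: 'a \<Rightarrow>\<^sub>L real. ((\<lambda>n. blinfun_apply g (v n)) \<longlongrightarrow> blinfun_apply g l) F)"
proof -
  have "limitin weak_topology v l F \<longleftrightarrow> ((\<lambda>n. evaluation (v n)) \<longlongrightarrow> evaluation l) F"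
    by (auto simp: limitin_def tendsto_def openin_weak_iff)
  also have "\<dots> \<longleftrightarrow> (\<forall>g. ((\<lambda>n. evaluation (v n) g) \<longlongrightarrow> evaluation l g) F)"
    using limitin_componentwise[of "\<lambda>_. euclideanreal" UNIV "\<lambda>n. evaluation (v n)" "evaluation l" F]
    unfolding euclidean_product_topology limitin_canonical_iff by simp
  finally show ?thesis by (simp add: evaluation_def)
qed

text \<open>Hahn-Banach gives a functional vanishing on \<open>Y\<close> but not at a given outside
  point; the set where it is nonzero is a weak neighbourhood of that point missing
  \<open>Y\<close>.\<close>

lemma closedin_weak_subspace:
  fixes Y :: "'a::real_normed_vector set"
  assumes "subspace Y" "closed Y"
  shows "closedin weak_topology Y"
proof -
  have "openin weak_topology (- Y)"
  proof (subst openin_subopen, safe)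
    fix x assume "x \<notin> Y"
    then obtain g :: "'a \<Rightarrow>\<^sub>L real" where g: "\<And>y. y \<in> Y \<Longrightarrow> blinfun_apply g y = 0" "blinfun_apply g x \<noteq> 0"
      using separating_functional[OF assms] by metis
    have "openin weak_topology (blinfun_apply g -` (- {0}))"
      by (rule openin_weak_vimage) auto
    then show "\<exists>T. openin weak_topology T \<and> x \<in> T \<and> T \<subseteq> - Y"
      using g by (intro exI[of _ "blinfun_apply g -` (- {0})"]) auto
  qed
  then show ?thesis by (simp add: closedin_def Compl_eq_Diff_UNIV)
qed

section \<open>Countable rational spans and their closures\<close>

definition rat_span :: "'a::real_vector set \<Rightarrow> 'a set" where
  "rat_span C = (\<lambda>l. sum_list (map (\<lambda>(r :: rat, c). of_rat r *\<^sub>R c) l)) ` lists (UNIV \<times> C)"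

lemma countable_rat_span: "countable C \<Longrightarrow> countable (rat_span C)"
  unfolding rat_span_def by (intro countable_image countable_lists) auto

lemma rat_span_base: "c \<in> C \<Longrightarrow> c \<in> rat_span C"
  unfolding rat_span_def by (rule image_eqI[of _ _ "[(1, c)]"]) auto

lemma rat_span_zero: "0 \<in> rat_span C"
  unfolding rat_span_def by (rule image_eqI[of _ _ "[]"]) auto

lemma rat_span_mono: "C \<subseteq> D \<Longrightarrow> rat_span C \<subseteq> rat_span D"
  unfolding rat_span_def by (intro image_mono lists_mono) auto

lemma rat_span_add:
  assumes "x \<in> rat_span C" "y \<in> rat_span C"
  shows "x + y \<in> rat_span C"
proof -
  obtain k l where "k \<in> lists (UNIV \<times> C)" "l \<in> lists (UNIV \<times> C)"
    and "x = sum_list (map (\<lambda>(r :: rat, c). of_rat r *\<^sub>R c) k)" "y = sum_list (map (\<lambda>(r :: rat, c). of_rat r *\<^sub>R c) l)"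
    using assms by (auto simp: rat_span_def)
  then show ?thesis
    unfolding rat_span_def by (intro image_eqI[of _ _ "k @ l"]) auto
qed

lemma rat_span_scale:
  assumes "x \<in> rat_span C"
  shows "of_rat q *\<^sub>R x \<in> rat_span C"
proof -
  obtain l where l: "l \<in> lists (UNIV \<times> C)" and x: "x = sum_list (map (\<lambda>(r :: rat, c). of_rat r *\<^sub>R c) l)"
    using assms by (auto simp: rat_span_def)
  have "of_rat q *\<^sub>R x = sum_list (map (\<lambda>(r :: rat, c). of_rat r *\<^sub>R c) (map (\<lambda>(r, c). (q * r, c)) l))"
    unfolding x by (induction l) (auto simp: scaleR_add_right of_rat_mult)
  moreover have "map (\<lambda>(r, c). (q * r, c)) l \<in> lists (UNIV \<times> C)" using l by auto
  ultimately show ?thesis unfolding rat_span_def by blast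
qed

text \<open>Rational coefficients keep the span countable, and density of the rationals restores
  real scalars after closure. Addition and scaling extend to closures by continuity on the
  product.\<close>

lemma subspace_closure_rat_span:
  fixes C :: "'a::real_normed_vector set"
  shows "subspace (closure (rat_span C))"
proof (rule subspaceI)
  let ?D = "closure (rat_span C)"
  show "0 \<in> ?D" using closure_subset rat_span_zero by blast
  have "(\<lambda>p. fst p + snd p) ` closure (rat_span C \<times> rat_span C) \<subseteq> ?D"
    by (rule image_closure_subset) (use rat_span_add closure_subset in \<open>force intro!: continuous_intros\<close>)+
  then show "x + y \<in> ?D" if "x \<in> ?D" "y \<in> ?D" for x y
    using that by (force simp: closure_Times)
  have "(\<lambda>p. fst p *\<^sub>R snd p) ` closure (\<rat> \<times> rat_span C) \<subseteq> ?D"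
  proof (rule image_closure_subset)
    show "(\<lambda>p. fst p *\<^sub>R snd p) ` (\<rat> \<times> rat_span C) \<subseteq> ?D"
      using rat_span_scale closure_subset by (fastforce elim: Rats_cases)
  qed (auto intro!: continuous_intros)
  then show "r *\<^sub>R x \<in> ?D" if "x \<in> ?D" for r x
    using that by (force simp: closure_Times Rats_closure_real)
qed

section \<open>Weak compactness implies weak sequential compactness\<close>

definition seq_compactin :: "'a topology \<Rightarrow> 'a set \<Rightarrow> bool" where
  "seq_compactin X S \<longleftrightarrow> (\<forall>v :: nat \<Rightarrow> 'a. (\<forall>n. v n \<in> S) \<longrightarrow>
     (\<exists>l\<in>S. \<exists>r. strict_mono r \<and> limitin X (v \<circ> r) l sequentially))"

text \<open>Norming functionals of the points of \<open>D\<close> suffice: if all of them vanish at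
  \<open>z\<close> and \<open>d n\<close> is within \<open>norm z / 2\<close> of \<open>z\<close>,
  then \<open>norm (d n) \<le> norm (d n - z) < norm z / 2\<close>, contradicting the triangle
  inequality.\<close>

lemma countable_separating_functionals:
  fixes D :: "'a::real_normed_vector set"
  assumes D: "countable D" "D \<noteq> {}" "subspace (closure D)"
  obtains g :: "nat \<Rightarrow> 'a \<Rightarrow>\<^sub>L real" where "inj_on (\<lambda>x n. blinfun_apply (g n) x) (closure D)"
proof -
  define d where "d = from_nat_into D"
  have d: "range d = D" unfolding d_def using D by (simp add: range_from_nat_into)
  have "\<forall>n. \<exists>g :: 'a \<Rightarrow>\<^sub>L real. norm g \<le> 1 \<and> blinfun_apply g (d n) = norm (d n)"
    using norming_functional by metis
  then obtain g :: "nat \<Rightarrow> 'a \<Rightarrow>\<^sub>L real"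
    where g: "\<And>n. norm (g n) \<le> 1" "\<And>n. blinfun_apply (g n) (d n) = norm (d n)" by metis
  have zero: "z = 0" if z: "z \<in> closure D" "\<And>n. blinfun_apply (g n) z = 0" for z
  proof (rule ccontr)
    assume "z \<noteq> 0"
    then obtain n where n: "dist (d n) z < norm z / 2"
      using z(1) d by (metis closure_approachable half_gt_zero image_iff zero_less_norm_iff)
    have "norm (d n) = blinfun_apply (g n) (d n - z)"
      using g(2) z(2) by (simp add: blinfun.diff_right)
    also have "\<dots> \<le> norm (g n) * norm (d n - z)"
      using norm_blinfun[of "g n" "d n - z"] by simp
    also have "\<dots> \<le> norm (d n - z)"
      using g(1)[of n] by (simp add: mult_left_le_one_le)
    finally show False
      using n norm_triangle_ineq2[of z "d n"] by (simp add: dist_norm norm_minus_commute)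
  qed
  show ?thesis
  proof (rule that, rule inj_onI)
    fix x y assume "x \<in> closure D" "y \<in> closure D"
      and "(\<lambda>n. blinfun_apply (g n) x) = (\<lambda>n. blinfun_apply (g n) y)"
    then show "x = y"
      using zero[of "x - y"] subspace_diff[OF D(3), of x y] by (simp add: blinfun.diff_right fun_eq_iff)
  qed
qed

text \<open>In the separable closed span of the sequence, countably many functionals separate
  points, so a weakly compact set is mapped continuously and injectively into a metrizable sequence
  space. A subsequence converges there, and compactness carries the convergence back.\<close>

proposition compactin_weak_imp_seq_compactin:
  fixes S :: "'a::real_normed_vector set"
  assumes S: "compactin weak_topology S"
  shows "seq_compactin weak_topology S"
  unfolding seq_compactin_def
proof (intro allI impI)
  fix v :: "nat \<Rightarrow> 'a" assume v: "\<forall>n. v n \<in> S"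
  define Y where "Y = closure (rat_span (range v))"
  have Y: "subspace Y" "closed Y"
    by (simp_all add: Y_def subspace_closure_rat_span)
  have vY: "v n \<in> Y" for n
    unfolding Y_def by (intro subsetD[OF closure_subset] rat_span_base) simp
  define K where "K = Y \<inter> S"
  have K: "compactin weak_topology K"
    unfolding K_def by (rule closed_Int_compactin[OF closedin_weak_subspace[OF Y] S])
  have "countable (rat_span (range v))" by (simp add: countable_rat_span)
  moreover have "rat_span (range v) \<noteq> {}" using rat_span_zero[of "range v"] by auto
  ultimately obtain g :: "nat \<Rightarrow> 'a \<Rightarrow>\<^sub>L real" where inj: "inj_on (\<lambda>x n. blinfun_apply (g n) x) Y"
    using subspace_closure_rat_span unfolding Y_def by (rule countable_separating_functionals)
  define G where "G = (\<lambda>x n. blinfun_apply (g n) x)"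
  have cont: "continuous_map weak_topology euclidean G"
    unfolding G_def by (intro continuous_map_into_function_space continuous_map_weak_blinfun)
  have comp: "compact (G ` C)" if "compactin weak_topology C" for C
    using image_compactin[OF that cont] by simp
  have "seq_compact (G ` K)"
    using comp[OF K] by (simp add: compact_eq_seq_compact_metric)
  moreover have "\<forall>n. G (v n) \<in> G ` K" using v vY by (auto simp: K_def)
  ultimately obtain L r where "L \<in> G ` K" and r: "strict_mono r" "((\<lambda>n. G (v n)) \<circ> r) \<longlonglongrightarrow> L"
    by (rule seq_compactE)
  then obtain l where l: "l \<in> K" and lim: "((\<lambda>n. G (v n)) \<circ> r) \<longlonglongrightarrow> G l" by blast
  have "(\<lambda>n. blinfun_apply h ((v \<circ> r) n)) \<longlonglongrightarrow> blinfun_apply h l" for h :: "'a \<Rightarrow>\<^sub>L real"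
  proof (rule tendstoI)
    fix e :: real assume "e > 0"
    \<comment> \<open>\<open>C\<close> is the part of \<open>K\<close> on which \<open>h\<close>
      stays at distance at least \<open>e\<close> from its value at \<open>l\<close>. Its image is
      compact, hence closed, and misses \<open>G l\<close> by injectivity, so the images of the
      subsequence eventually avoid it.\<close>
    define C where "C = blinfun_apply h -` (- ball (blinfun_apply h l) e) \<inter> K"
    have "closedin weak_topology (blinfun_apply h -` (- ball (blinfun_apply h l) e))"
      using openin_weak_vimage[of "ball (blinfun_apply h l) e" h]
      by (simp add: closedin_def vimage_Compl flip: Compl_eq_Diff_UNIV)
    then have "compactin weak_topology C"
      unfolding C_def using K by (rule closed_Int_compactin)
    then have "open (- G ` C)"
      using comp compact_imp_closed by blast
    moreover have "G l \<notin> G ` C"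
    proof
      assume "G l \<in> G ` C"
      then obtain c where c: "c \<in> C" "G l = G c" by auto
      then have "l = c"
        using l inj by (auto simp: C_def K_def G_def inj_on_def)
      with c(1) \<open>e > 0\<close> show False by (simp add: C_def)
    qed
    ultimately have "\<forall>\<^sub>F n in sequentially. G (v (r n)) \<in> - G ` C"
      using topological_tendstoD[OF lim, of "- G ` C"] by simp
    then show "\<forall>\<^sub>F n in sequentially. dist (blinfun_apply h ((v \<circ> r) n)) (blinfun_apply h l) < e"
    proof eventually_elim
      case (elim n)
      then have "v (r n) \<notin> C" by blast
      then show ?case using v vY by (simp add: C_def K_def dist_commute)
    qed
  qed
  then have "limitin weak_topology (v \<circ> r) l sequentially" by (simp add: limitin_weak_iff)
  with l r(1) show "\<exists>l\<in>S. \<exists>r. strict_mono r \<and> limitin weak_topology (v \<circ> r) l sequentially"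
    by (auto simp: K_def)
qed

section \<open>Weak sequential compactness implies weak compactness\<close>

lemma pointwise_bounded_imp_bounded:
  fixes S :: "'a::real_normed_vector set"
  assumes bd: "\<And>g :: 'a \<Rightarrow>\<^sub>L real. \<exists>B. \<forall>s\<in>S. \<bar>blinfun_apply g s\<bar> \<le> B"
  obtains M where "\<And>g :: 'a \<Rightarrow>\<^sub>L real. \<And>s. norm g \<le> 1 \<Longrightarrow> s \<in> S \<Longrightarrow> \<bar>blinfun_apply g s\<bar> \<le> M"
proof -
  define A where "A n = (\<Inter>s\<in>S. {g :: 'a \<Rightarrow>\<^sub>L real. \<bar>blinfun_apply g s\<bar> \<le> real n})" for n
  have closed: "closed (A n)" for n
    unfolding A_def by (intro closed_INT ballI closed_Collect_le continuous_intros)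
  have union: "\<Union>(range A) = UNIV"
  proof -
    have "\<exists>n. g \<in> A n" for g
    proof -
      obtain B where "\<And>s. s \<in> S \<Longrightarrow> \<bar>blinfun_apply g s\<bar> \<le> B" using bd by metis
      moreover obtain n where "B \<le> real n" using real_arch_simple by blast
      ultimately show ?thesis by (force simp: A_def intro: order_trans)
    qed
    then show ?thesis by auto
  qed
  \<comment> \<open>The sets \<open>A n\<close> are closed and cover the dual, which is complete, so
    Baire's theorem gives one of them an interior point.\<close>
  have "\<exists>n. interior (A n) \<noteq> {}"
  proof (rule ccontr)
    assume empty: "\<not> (\<exists>n. interior (A n) \<noteq> {})"
    have "Met_TC.mtopology interior_of \<Union>(range A) = {}"
    proof (rule Met_TC.metric_Baire_category_alt)
      show "Met_TC.mcomplete TYPE('a \<Rightarrow>\<^sub>L real)" using complete_UNIV by blast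
      show "closedin Met_TC.mtopology T \<and> Met_TC.mtopology interior_of T = {}" if "T \<in> range A" for T
        using that closed empty by (auto simp: interior_of_def interior_def)
    qed simp
    then show False by (simp add: union interior_of_def) blast
  qed
  then obtain n g0 e where e: "e > 0" "cball g0 e \<subseteq> A n"
    unfolding ex_in_conv[symmetric] mem_interior_cball by blast
  show ?thesis
  proof
    fix g :: "'a \<Rightarrow>\<^sub>L real" and s assume g: "norm g \<le> 1" and s: "s \<in> S"
    \<comment> \<open>Both \<open>g0\<close> and \<open>g0 + e *\<^sub>R g\<close> lie in the ball
      inside \<open>A n\<close>; their difference gives the bound
      \<open>2 * real n / e\<close>.\<close>
    have "g0 + e *\<^sub>R g \<in> A n" "g0 \<in> A n"
      using e g by (auto intro!: subsetD[OF e(2)] simp: dist_norm mult_left_le)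
    then have "\<bar>blinfun_apply g0 s + e * blinfun_apply g s\<bar> \<le> real n" "\<bar>blinfun_apply g0 s\<bar> \<le> real n"
      using s by (auto simp: A_def blinfun.add_left blinfun.scaleR_left)
    then have "\<bar>e * blinfun_apply g s\<bar> \<le> 2 * real n" by linarith
    then show "\<bar>blinfun_apply g s\<bar> \<le> 2 * real n / e"
      using e(1) by (simp add: abs_mult field_simps)
  qed
qed

text \<open>A countable product of real lines is metrizable, so compactness of the image can be
  tested on sequences, and these lift to \<open>S\<close>.\<close>

lemma seq_compactin_weak_imp_compact_image:
  fixes S :: "'a::real_normed_vector set" and g :: "nat \<Rightarrow> 'a \<Rightarrow>\<^sub>L real"
  assumes S: "seq_compactin weak_topology S"
  shows "compact ((\<lambda>x n. blinfun_apply (g n) x) ` S)"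
  unfolding compact_eq_seq_compact_metric
proof (rule seq_compactI)
  fix f :: "nat \<Rightarrow> nat \<Rightarrow> real" assume "\<forall>n. f n \<in> (\<lambda>x n. blinfun_apply (g n) x) ` S"
  then have "\<forall>n. \<exists>x. x \<in> S \<and> f n = (\<lambda>i. blinfun_apply (g i) x)" by blast
  from choice[OF this] obtain v where v: "\<And>n. v n \<in> S" "\<And>n. f n = (\<lambda>i. blinfun_apply (g i) (v n))"
    by blast
  then obtain l r where l: "l \<in> S" "strict_mono r" "limitin weak_topology (v \<circ> r) l sequentially"
    using S unfolding seq_compactin_def by metis
  have "(f \<circ> r) \<longlonglongrightarrow> (\<lambda>i. blinfun_apply (g i) l)"
    using limitin_componentwise[of "\<lambda>_. euclideanreal" UNIV "f \<circ> r" "\<lambda>i. blinfun_apply (g i) l" sequentially] l(3)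
    unfolding euclidean_product_topology limitin_canonical_iff limitin_weak_iff
    by (simp add: v(2) o_def)
  with l show "\<exists>l\<in>(\<lambda>x n. blinfun_apply (g n) x) ` S. \<exists>r. strict_mono r \<and> (f \<circ> r) \<longlonglongrightarrow> l"
    by blast
qed

lemma seq_compactin_weak_imp_pointwise_bounded:
  fixes S :: "'a::real_normed_vector set" and g :: "'a \<Rightarrow>\<^sub>L real"
  assumes S: "seq_compactin weak_topology S"
  shows "\<exists>B. \<forall>s\<in>S. \<bar>blinfun_apply g s\<bar> \<le> B"
proof -
  \<comment> \<open>The constant sequence of functionals is used; coordinate 0 then recovers
    \<open>g\<close>.\<close>
  have "compact ((\<lambda>\<theta>. \<theta> (0 :: nat)) ` (\<lambda>x n. blinfun_apply g x) ` S)"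
    by (rule compact_continuous_image[OF _ seq_compactin_weak_imp_compact_image[OF S, of "\<lambda>_. g"]])
      (rule continuous_on_subset[OF continuous_on_product_coordinates subset_UNIV])
  then show ?thesis
    using compact_imp_bounded by (force simp: image_image bounded_iff)
qed

text \<open>\<open>P\<close> restricts a function on the dual to the countable set
  \<open>\<Phi>\<close>. The image of the evaluations is compact, hence closed, so restricting a
  point of their closure gives nothing new.\<close>

lemma closure_evaluation_interpolate:
  fixes S :: "'a::real_normed_vector set"
  assumes S: "seq_compactin weak_topology S" and \<Lambda>: "\<Lambda> \<in> closure (evaluation ` S)"
    and \<Phi>: "countable \<Phi>"
  shows "\<exists>y\<in>S. \<forall>\<phi>\<in>\<Phi>. blinfun_apply \<phi> y = \<Lambda> \<phi>"
proof (cases "\<Phi> = {}")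
  case True
  then show ?thesis using \<Lambda> by (cases "S = {}") auto
next
  case False
  define g where "g = from_nat_into \<Phi>"
  have g: "range g = \<Phi>" unfolding g_def using \<Phi> False by (simp add: range_from_nat_into)
  define P where "P = (\<lambda>\<theta> :: ('a \<Rightarrow>\<^sub>L real) \<Rightarrow> real. \<lambda>n. \<theta> (g n))"
  have cont: "continuous_on X P" for X
    unfolding P_def
    by (intro continuous_on_coordinatewise_then_product
        continuous_on_subset[OF continuous_on_product_coordinates subset_UNIV])
  have PE: "P ` evaluation ` S = (\<lambda>x n. blinfun_apply (g n) x) ` S"
    by (simp add: image_image P_def evaluation_def)
  have "P ` closure (evaluation ` S) \<subseteq> P ` evaluation ` S"
    by (intro image_closure_subset cont order_refl)
      (simp add: PE compact_imp_closed seq_compactin_weak_imp_compact_image[OF S])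
  then obtain y where y: "y \<in> S" "P \<Lambda> = P (evaluation y)" using \<Lambda> by blast
  then have "blinfun_apply \<phi> y = \<Lambda> \<phi>" if "\<phi> \<in> \<Phi>" for \<phi>
    using that g by (force simp: P_def evaluation_def fun_eq_iff)
  with y(1) show ?thesis by blast
qed

text \<open>The supremum of the differences over the unit ball need not be attained; the factor 2
  leaves room to choose a \<open>\<phi>\<close> above half of it. A nonpositive supremum makes all
  differences vanish, and \<open>\<phi> = 0\<close> works.\<close>

lemma half_norming_functional:
  fixes \<Lambda> :: "('a::real_normed_vector \<Rightarrow>\<^sub>L real) \<Rightarrow> real"
  assumes bd: "\<And>g. norm g \<le> 1 \<Longrightarrow> \<bar>\<Lambda> g\<bar> \<le> M"
  shows "\<exists>\<phi>. norm \<phi> \<le> 1 \<and>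
    (\<forall>g. norm g \<le> 1 \<longrightarrow> \<bar>\<Lambda> g - blinfun_apply g q\<bar> \<le> 2 * \<bar>\<Lambda> \<phi> - blinfun_apply \<phi> q\<bar>)"
proof -
  let ?d = "\<lambda>g. \<bar>\<Lambda> g - blinfun_apply g q\<bar>"
  let ?B = "{g :: 'a \<Rightarrow>\<^sub>L real. norm g \<le> 1}"
  have "?d g \<le> M + norm q" if "norm g \<le> 1" for g
  proof -
    have "\<bar>blinfun_apply g q\<bar> \<le> norm q"
      using norm_blinfun[of g q] mult_right_mono[OF that, of "norm q"] by simp
    with bd[OF that] show ?thesis by linarith
  qed
  then have bdd: "bdd_above (?d ` ?B)" by (auto intro!: bdd_aboveI2)
  define s where "s = Sup (?d ` ?B)"
  have upper: "?d g \<le> s" if "norm g \<le> 1" for g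
    unfolding s_def using that by (intro cSUP_upper bdd) auto
  show ?thesis
  proof (cases "s \<le> 0")
    case True
    then show ?thesis using upper by (intro exI[of _ 0]) (force intro: order_trans)
  next
    case False
    have "?d ` ?B \<noteq> {}" by (auto intro!: exI[of _ 0])
    moreover have "s / 2 < Sup (?d ` ?B)" using False by (simp add: s_def[symmetric])
    ultimately obtain \<phi> where "norm \<phi> \<le> 1" "s / 2 < ?d \<phi>"
      using less_cSupE[of "s / 2" "?d ` ?B"] by auto
    then show ?thesis using upper by (intro exI[of _ \<phi>]) (force intro: order_trans)
  qed
qed

text \<open>A rational combination involves finitely many points, so each \<open>q\<close> is
  available from some stage of an inductive construction on.\<close>

lemma rat_span_range_finite:
  assumes "q \<in> rat_span (range (y :: nat \<Rightarrow> 'a::real_vector))"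
  obtains k where "q \<in> rat_span (y ` {..<k})"
proof -
  obtain l where l: "l \<in> lists (UNIV \<times> range y)"
    and q: "q = sum_list (map (\<lambda>(r :: rat, c). of_rat r *\<^sub>R c) l)"
    using assms by (auto simp: rat_span_def)
  have "finite (snd ` set l)" "snd ` set l \<subseteq> range y" using l by auto
  then obtain I where I: "finite I" "snd ` set l = y ` I"
    by (meson finite_subset_image)
  obtain k where "I \<subseteq> {..<k}"
    using I(1) finite_nat_iff_bounded by blast
  then have "l \<in> lists (UNIV \<times> y ` {..<k})"
    using I(2) by (force simp: in_lists_conv_set)
  then show ?thesis using that q unfolding rat_span_def by blast
qed

text \<open>Whitley's argument: each new point agrees with \<open>\<Lambda>\<close> on functionals that half-norm \<open>\<Lambda> - q\<close>,
  for all \<open>q\<close> in the rational span of the previous points. A limit of these points lies in the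
  closure of the rational span, so these functionals detect its distance to \<open>\<Lambda>\<close>.\<close>
lemma closed_evaluation_image:
  fixes S :: "'a::real_normed_vector set"
  assumes S: "seq_compactin weak_topology S"
  shows "closed (evaluation ` S)"
proof -
  have "\<Lambda> \<in> evaluation ` S" if \<Lambda>: "\<Lambda> \<in> closure (evaluation ` S)" for \<Lambda>
  proof -
    obtain M where M: "\<And>g :: 'a \<Rightarrow>\<^sub>L real. \<And>s. norm g \<le> 1 \<Longrightarrow> s \<in> S \<Longrightarrow> \<bar>blinfun_apply g s\<bar> \<le> M"
      using pointwise_bounded_imp_bounded seq_compactin_weak_imp_pointwise_bounded[OF S] by metis
    \<comment> \<open>\<open>\<Lambda>\<close> lies in the pointwise closure of evaluations and
      inherits closed conditions on coordinates: a bound on the unit ball here, homogeneity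
      next.\<close>
    have bd: "\<bar>\<Lambda> g\<bar> \<le> M" if "norm g \<le> 1" for g
    proof -
      have "closure (evaluation ` S) \<subseteq> {\<theta>. \<bar>\<theta> g\<bar> \<le> M}"
        by (intro closure_minimal closed_Collect_le continuous_intros continuous_on_product_coordinates)
          (use M[OF that] in \<open>auto simp: evaluation_def\<close>)
      then show ?thesis using \<Lambda> by blast
    qed
    have scale: "\<Lambda> (c *\<^sub>R g) = c * \<Lambda> g" for c g
    proof -
      have "closure (evaluation ` S) \<subseteq> {\<theta>. \<theta> (c *\<^sub>R g) = c * \<theta> g}"
        by (intro closure_minimal closed_Collect_eq continuous_intros continuous_on_product_coordinates)
          (auto simp: evaluation_def blinfun.scaleR_left)
      then show ?thesis using \<Lambda> by blast
    qed
    have "\<forall>q. \<exists>\<phi>. norm \<phi> \<le> 1 \<and>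
        (\<forall>g. norm g \<le> 1 \<longrightarrow> \<bar>\<Lambda> g - blinfun_apply g q\<bar> \<le> 2 * \<bar>\<Lambda> \<phi> - blinfun_apply \<phi> q\<bar>)"
      by (intro allI half_norming_functional[OF bd])
    from choice[OF this] obtain \<phi> where \<phi>: "\<And>q. norm (\<phi> q) \<le> 1"
      "\<And>q g. norm g \<le> 1 \<Longrightarrow> \<bar>\<Lambda> g - blinfun_apply g q\<bar> \<le> 2 * \<bar>\<Lambda> (\<phi> q) - blinfun_apply (\<phi> q) q\<bar>"
      by blast
    \<comment> \<open>The constraint at stage \<open>k\<close> mentions only the points before
      \<open>k\<close>, as recursive choice requires. At \<open>k = 0\<close> the span is
      \<open>{0}\<close>, not empty.\<close>
    define P where "P f k z \<longleftrightarrow> z \<in> S \<and> (\<forall>q\<in>rat_span (f ` {..<k}). blinfun_apply (\<phi> q) z = \<Lambda> (\<phi> q))"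
      for f :: "nat \<Rightarrow> 'a" and k z
    have "\<exists>y. \<forall>k. P y k (y k)"
    proof (rule dependent_wellorder_choice)
      fix z and f g :: "nat \<Rightarrow> 'a" and k assume "\<And>j. j < k \<Longrightarrow> f j = g j"
      then have "f ` {..<k} = g ` {..<k}" by auto
      then show "P f k z = P g k z" by (simp add: P_def)
    next
      fix k and f :: "nat \<Rightarrow> 'a"
      have "countable (\<phi> ` rat_span (f ` {..<k}))"
        by (intro countable_image countable_rat_span) simp
      from closure_evaluation_interpolate[OF S \<Lambda> this]
      show "\<exists>z. P f k z" by (auto simp: P_def)
    qed
    then obtain y where "\<And>k. P y k (y k)" by auto
    then have y: "y k \<in> S" "q \<in> rat_span (y ` {..<k}) \<Longrightarrow> blinfun_apply (\<phi> q) (y k) = \<Lambda> (\<phi> q)" for k q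
      by (simp_all add: P_def)
    obtain x r where x: "x \<in> S" and r: "strict_mono r" and lim: "limitin weak_topology (y \<circ> r) x sequentially"
      using S y(1) unfolding seq_compactin_def by metis
    define D where "D = rat_span (range y)"
    have agree: "blinfun_apply (\<phi> q) x = \<Lambda> (\<phi> q)" if q: "q \<in> D" for q
    proof -
      obtain k where k: "q \<in> rat_span (y ` {..<k})"
        using q unfolding D_def by (rule rat_span_range_finite)
      \<comment> \<open>From index \<open>k\<close> on the agreement is exact, so the limit inherits
        it.\<close>
      have "blinfun_apply (\<phi> q) ((y \<circ> r) n) = \<Lambda> (\<phi> q)" if "k \<le> n" for n
      proof -
        have "k \<le> r n" using that seq_suble[OF r, of n] by linarith
        then have "rat_span (y ` {..<k}) \<subseteq> rat_span (y ` {..<r n})"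
          by (intro rat_span_mono image_mono) auto
        then show ?thesis using k y(2)[of q "r n"] by auto
      qed
      then have "(\<lambda>n. blinfun_apply (\<phi> q) ((y \<circ> r) n)) \<longlonglongrightarrow> \<Lambda> (\<phi> q)"
        by (intro tendsto_eventually eventually_sequentiallyI[of k])
      then show ?thesis
        using lim LIMSEQ_unique unfolding limitin_weak_iff by blast
    qed
    \<comment> \<open>Weak limits may leave a norm-closed set in general, but not a closed subspace;
      so \<open>x\<close> is a norm limit of rational combinations.\<close>
    have "x \<in> closure D"
    proof (rule limitin_closedin[OF lim])
      show "closedin weak_topology (closure D)"
        unfolding D_def by (intro closedin_weak_subspace subspace_closure_rat_span closed_closure)
      have "y k \<in> closure D" for k
        unfolding D_def by (intro subsetD[OF closure_subset] rat_span_base) simp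
      then show "\<forall>\<^sub>F n in sequentially. (y \<circ> r) n \<in> closure D" by simp
    qed simp
    have unit: "\<Lambda> g = blinfun_apply g x" if g: "norm g \<le> 1" for g
    proof -
      have "\<bar>\<Lambda> g - blinfun_apply g x\<bar> \<le> 0 + e" if "e > 0" for e
      proof -
        \<comment> \<open>The choice \<open>e / 3\<close>: half-norming doubles the error at
          \<open>\<phi> q\<close>, and moving from \<open>q\<close> to \<open>x\<close> adds one
          more.\<close>
        obtain q where q: "q \<in> D" "dist q x < e / 3"
          using \<open>x \<in> closure D\<close> \<open>e > 0\<close> unfolding closure_approachable
          by (meson divide_pos_pos zero_less_numeral)
        have le: "\<bar>blinfun_apply h q - blinfun_apply h x\<bar> \<le> e / 3" if "norm h \<le> 1" for h :: "'a \<Rightarrow>\<^sub>L real"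
          using norm_blinfun[of h "q - x"] mult_right_mono[OF that, of "norm (q - x)"] q(2)
          by (simp add: blinfun.diff_right dist_norm)
        have "\<bar>\<Lambda> (\<phi> q) - blinfun_apply (\<phi> q) q\<bar> \<le> e / 3"
          using le[OF \<phi>(1), of q] agree[OF q(1)] by (simp add: abs_minus_commute)
        then have "\<bar>\<Lambda> g - blinfun_apply g q\<bar> \<le> 2 * (e / 3)"
          by (intro order_trans[OF \<phi>(2)[OF g, of q]] mult_left_mono) auto
        then show ?thesis
          using le[OF g] abs_triangle_ineq[of "\<Lambda> g - blinfun_apply g q" "blinfun_apply g q - blinfun_apply g x"]
          by simp
      qed
      then have "\<bar>\<Lambda> g - blinfun_apply g x\<bar> \<le> 0" by (rule field_le_epsilon)
      then show ?thesis by simp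
    qed
    have "\<Lambda> g = blinfun_apply g x" for g
    proof -
      \<comment> \<open>Adding 1 keeps the factor defined at \<open>g = 0\<close> while bringing
        \<open>g\<close> into the unit ball.\<close>
      let ?c = "inverse (1 + norm g)"
      have pos: "0 < 1 + norm g" by (simp add: add_pos_nonneg)
      then have "norm (?c *\<^sub>R g) \<le> 1" by (simp add: field_simps)
      from unit[OF this] have "?c * \<Lambda> g = ?c * blinfun_apply g x"
        by (simp add: scale blinfun.scaleR_left)
      with pos show ?thesis by simp
    qed
    then show ?thesis using x by (auto simp: evaluation_def fun_eq_iff image_iff)
  qed
  then show ?thesis by (metis closure_subset closure_eq subsetI subset_antisym)
qed

text \<open>Pointwise bounds place the evaluations in a product of compact intervals, compact by
  Tychonoff; closedness of the image then makes it compact.\<close>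

proposition seq_compactin_weak_imp_compactin:
  fixes S :: "'a::real_normed_vector set"
  assumes S: "seq_compactin weak_topology S"
  shows "compactin weak_topology S"
proof -
  obtain B where B: "\<And>(g :: 'a \<Rightarrow>\<^sub>L real) s. s \<in> S \<Longrightarrow> \<bar>blinfun_apply g s\<bar> \<le> B g"
    using seq_compactin_weak_imp_pointwise_bounded[OF S] by metis
  have "compactin (product_topology (\<lambda>_. euclidean) UNIV) (PiE UNIV (\<lambda>g. {- B g..B g}))"
    unfolding compactin_PiE by auto
  then have "compact (PiE UNIV (\<lambda>g. {- B g..B g}))"
    unfolding euclidean_product_topology by simp
  moreover have "evaluation ` S \<subseteq> PiE UNIV (\<lambda>g. {- B g..B g})"
    using B by (force simp: evaluation_def abs_le_iff)
  ultimately have "compact (evaluation ` S)"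
    using compact_Int_closed[OF _ closed_evaluation_image[OF S]] by (metis inf.absorb2)
  then show ?thesis by (simp add: compactin_weak_iff)
qed

theorem Eberlein_Smulian:
  fixes S :: "'a::real_normed_vector set"
  shows "compactin weak_topology S \<longleftrightarrow> seq_compactin weak_topology S"
  using compactin_weak_imp_seq_compactin seq_compactin_weak_imp_compactin by blast

section \<open>Minimizing sequences\<close>

lemma convex_monotone_fun_mono:
  assumes "convex_monotone_fun F f" "\<phi> \<in> linf_pos F" "\<psi> \<in> linf_pos F" "\<forall>t\<in>F. \<phi> t \<le> \<psi> t"
  shows "f \<phi> \<le> f \<psi>"
  using assms by (simp add: convex_monotone_fun_def)

lemma convex_monotone_fun_convex:
  fixes u :: real
  assumes "convex_monotone_fun F f" "\<phi> \<in> linf_pos F" "\<psi> \<in> linf_pos F" "0 \<le> u" "u \<le> 1"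
  shows "f (\<lambda>t. u * \<phi> t + (1 - u) * \<psi> t) \<le> u * f \<phi> + (1 - u) * f \<psi>"
  using assms by (simp add: convex_monotone_fun_def)

lemma convex_monotone_fun_scale:
  fixes s :: real
  assumes f: "convex_monotone_fun F f" and \<phi>: "\<phi> \<in> linf_pos F" and s: "0 < s" "s < 1"
  shows "(1 + s) * f \<phi> - s * f (\<lambda>t. 2 * \<phi> t) \<le> f (\<lambda>t. (1 - s) * \<phi> t)"
proof -
  \<comment> \<open>With this weight \<open>\<phi>\<close> is the convex combination of
    \<open>(1 - s) * \<phi>\<close> and \<open>2 * \<phi>\<close>, as
    \<open>u * (1 - s) + (1 - u) * 2 = 1\<close>; convexity at \<open>\<phi>\<close> then bounds the
    shrunken value from below.\<close>
  define u where "u = 1 / (1 + s)"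
  have u: "0 \<le> u" "u \<le> 1" "(1 + s) * u = 1" using s by (auto simp: u_def)
  let ?A = "f (\<lambda>t. (1 - s) * \<phi> t)" and ?B = "f (\<lambda>t. 2 * \<phi> t)"
  have "u * ((1 - s) * x) + (1 - u) * (2 * x) = 2 * x - ((1 + s) * u) * x" for x
    by (simp add: algebra_simps)
  then have eq: "(\<lambda>t. u * ((1 - s) * \<phi> t) + (1 - u) * (2 * \<phi> t)) = \<phi>"
    by (simp add: u(3))
  have "(\<lambda>t. (1 - s) * \<phi> t) \<in> linf_pos F" "(\<lambda>t. 2 * \<phi> t) \<in> linf_pos F"
    using \<phi> s by (auto simp: linf_pos_def)
  from convex_monotone_fun_convex[OF f this u(1,2)] have "f \<phi> \<le> u * ?A + (1 - u) * ?B"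
    by (simp only: eq)
  then have "(1 + s) * f \<phi> \<le> (1 + s) * (u * ?A + (1 - u) * ?B)"
    using s by (intro mult_left_mono) auto
  also have "\<dots> = ((1 + s) * u) * ?A + ((1 + s) - (1 + s) * u) * ?B"
    by (simp only: distrib_left right_diff_distrib left_diff_distrib mult.assoc mult_1_right mult_1_left)
  finally show ?thesis by (simp add: u(3))
qed

text \<open>Weak lower semicontinuity of the norm, in multiplicative form to fit the scaling of
  distance vectors. A norming functional of \<open>l - a\<close>, applied to \<open>v n - a\<close>,
  tends to \<open>norm (l - a)\<close>, which strictly exceeds \<open>(1 - s) * norm (l - a)\<close>
  unless \<open>l = a\<close>.\<close>

lemma eventually_norm_ge_of_weak_limit:
  fixes v :: "nat \<Rightarrow> 'a::real_normed_vector"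
  assumes lim: "limitin weak_topology v l sequentially" and s: "0 < s" "s < 1"
  shows "\<forall>\<^sub>F n in sequentially. (1 - s) * norm (l - a) \<le> norm (v n - a)"
proof (cases "l = a")
  case False
  obtain g :: "'a \<Rightarrow>\<^sub>L real" where g: "norm g \<le> 1" "blinfun_apply g (l - a) = norm (l - a)"
    by (rule norming_functional)
  have "(\<lambda>n. blinfun_apply g (v n) - blinfun_apply g a) \<longlonglongrightarrow> blinfun_apply g l - blinfun_apply g a"
    using lim by (intro tendsto_diff tendsto_const) (simp add: limitin_weak_iff)
  then have "(\<lambda>n. blinfun_apply g (v n - a)) \<longlonglongrightarrow> norm (l - a)"
    using g(2) by (simp add: blinfun.diff_right)
  moreover have "(1 - s) * norm (l - a) < norm (l - a)"
    using s False by (simp add: algebra_simps)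
  ultimately have "\<forall>\<^sub>F n in sequentially. (1 - s) * norm (l - a) < blinfun_apply g (v n - a)"
    by (rule order_tendstoD)
  then show ?thesis
  proof eventually_elim
    case (elim n)
    have "blinfun_apply g (v n - a) \<le> norm (v n - a)"
      using norm_blinfun[of g "v n - a"] mult_right_mono[OF g(1), of "norm (v n - a)"] by simp
    with elim show ?case by linarith
  qed
qed simp

lemma r_f_weak_lower_semicontinuous:
  fixes v :: "nat \<Rightarrow> 'a::real_normed_vector"
  assumes f: "convex_monotone_fun F f" and F: "finite F"
    and lim: "limitin weak_topology v l sequentially" and c: "(\<lambda>n. r_f f (v n) F) \<longlonglongrightarrow> c"
  shows "r_f f l F \<le> c"
proof -
  define \<phi> where "\<phi> x = (\<lambda>a. if a \<in> F then norm (x - a) else 0)" for x :: 'a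
  have \<phi>: "\<phi> x \<in> linf_pos F" for x by (auto simp: \<phi>_def linf_pos_def)
  have r: "r_f f x F = f (\<phi> x)" for x by (simp add: r_f_def \<phi>_def)
  have bound: "(1 + s) * f (\<phi> l) - s * f (\<lambda>t. 2 * \<phi> l t) \<le> c" if s: "0 < s" "s < 1" for s
  proof -
    \<comment> \<open>One index bound serves all \<open>a\<close> because \<open>F\<close> is
      finite.\<close>
    have "\<forall>\<^sub>F n in sequentially. \<forall>a\<in>F. (1 - s) * norm (l - a) \<le> norm (v n - a)"
      using F eventually_norm_ge_of_weak_limit[OF lim s] by (simp add: eventually_ball_finite_distrib)
    then have "\<forall>\<^sub>F n in sequentially. f (\<lambda>t. (1 - s) * \<phi> l t) \<le> r_f f (v n) F"
    proof eventually_elim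
      case (elim n)
      have "(\<lambda>t. (1 - s) * \<phi> l t) \<in> linf_pos F" using s by (auto simp: \<phi>_def linf_pos_def)
      moreover have "\<forall>t\<in>F. (1 - s) * \<phi> l t \<le> \<phi> (v n) t" using elim by (simp add: \<phi>_def)
      ultimately show ?case
        unfolding r by (intro convex_monotone_fun_mono[OF f _ \<phi>])
    qed
    from tendsto_lowerbound[OF c this] have "f (\<lambda>t. (1 - s) * \<phi> l t) \<le> c" by simp
    with convex_monotone_fun_scale[OF f \<phi> s, of l] show ?thesis by linarith
  qed
  \<comment> \<open>The value at twice \<open>\<phi> l\<close> is fixed and its coefficient tends to
    0, so the bound survives as \<open>f (\<phi> l) \<le> c\<close>.\<close>
  have "((\<lambda>s. (1 + s) * f (\<phi> l) - s * f (\<lambda>t. 2 * \<phi> l t)) \<longlongrightarrow> (1 + 0) * f (\<phi> l) - 0 * f (\<lambda>t. 2 * \<phi> l t)) (at_right 0)"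
    by (intro tendsto_intros)
  moreover have "\<forall>\<^sub>F s in at_right (0 :: real). (1 + s) * f (\<phi> l) - s * f (\<lambda>t. 2 * \<phi> l t) \<le> c"
    using eventually_at_right_real[OF zero_less_one] by eventually_elim (use bound in auto)
  ultimately have "(1 + 0) * f (\<phi> l) - 0 * f (\<lambda>t. 2 * \<phi> l t) \<le> c"
    by (rule tendsto_upperbound) simp
  then show ?thesis by (simp add: r)
qed

section \<open>The radius, minimizing sequences and centers\<close>

lemma rad_le:
  assumes f: "convex_monotone_fun F f" and v: "v \<in> V"
  shows "rad V f F \<le> r_f f v F"
proof -
  have "0 \<le> r_f f x F" for x
    using f by (auto simp: convex_monotone_fun_def r_f_def linf_pos_def)
  then show ?thesis
    unfolding rad_def using v by (intro cINF_lower bdd_belowI2) auto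
qed

lemma tendsto_radI:
  assumes f: "convex_monotone_fun F f" and v: "\<And>n. v n \<in> V"
    and le: "\<And>n. r_f f (v n) F \<le> rad V f F + 1 / (real n + 1)"
  shows "(\<lambda>n. r_f f (v n) F) \<longlonglongrightarrow> rad V f F"
proof (rule tendsto_sandwich[where f = "\<lambda>_. rad V f F"])
  have "(\<lambda>n. rad V f F + inverse (real (Suc n))) \<longlonglongrightarrow> rad V f F + 0"
    by (intro tendsto_add tendsto_const LIMSEQ_inverse_real_of_nat)
  then show "(\<lambda>n. rad V f F + 1 / (real n + 1)) \<longlonglongrightarrow> rad V f F"
    by (simp add: inverse_eq_divide add.commute)
  show "\<forall>\<^sub>F n in sequentially. rad V f F \<le> r_f f (v n) F"
    using rad_le[OF f v] by simp
  show "\<forall>\<^sub>F n in sequentially. r_f f (v n) F \<le> rad V f F + 1 / (real n + 1)"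
    using le by simp
qed (rule tendsto_const)

lemma minimizing_sequence:
  assumes f: "convex_monotone_fun F f" and "V \<noteq> {}"
  obtains v where "\<And>n :: nat. v n \<in> V" "(\<lambda>n. r_f f (v n) F) \<longlonglongrightarrow> rad V f F"
proof -
  have "\<exists>v\<in>V. r_f f v F < rad V f F + 1 / (real n + 1)" for n
    using cInf_lessD[of "(\<lambda>v. r_f f v F) ` V" "rad V f F + 1 / (real n + 1)"] assms(2)
    by (auto simp: rad_def)
  then obtain v where v: "\<And>n. v n \<in> V" "\<And>n. r_f f (v n) F < rad V f F + 1 / (real n + 1)"
    by metis
  show ?thesis
    by (rule that[of v, OF v(1) tendsto_radI[of F f v V, OF f v(1)]]) (simp add: less_imp_le v(2))
qed

text \<open>Norm convergence implies weak convergence, so lower semicontinuity in the weak topology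
  serves both choices of \<open>\<tau>\<close>.\<close>

lemma limitin_imp_weak:
  fixes v :: "nat \<Rightarrow> 'a::real_normed_vector"
  assumes "\<tau> = euclidean \<or> \<tau> = weak_topology" "limitin \<tau> v l sequentially"
  shows "limitin weak_topology v l sequentially"
  using assms(1)
proof
  assume "\<tau> = euclidean"
  then have "v \<longlonglongrightarrow> l" using assms(2) by simp
  then show ?thesis by (auto simp: limitin_weak_iff intro: tendsto_intros)
qed (use assms(2) in simp)

lemma compactin_iff_seq_compactin:
  fixes S :: "'a::real_normed_vector set"
  assumes "\<tau> = euclidean \<or> \<tau> = weak_topology"
  shows "compactin \<tau> S \<longleftrightarrow> seq_compactin \<tau> S"
  using assms
proof
  assume "\<tau> = euclidean"
  then show ?thesis by (simp add: seq_compactin_def compact_def)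
qed (simp add: Eberlein_Smulian)

lemma minimizing_limit_in_Cent:
  fixes V :: "'a::real_normed_vector set"
  assumes "\<tau> = euclidean \<or> \<tau> = weak_topology" "closedin \<tau> V" "finite F" "convex_monotone_fun F f"
    and v: "\<And>n. v n \<in> V" "(\<lambda>n. r_f f (v n) F) \<longlonglongrightarrow> rad V f F"
    and lim: "limitin \<tau> v l sequentially"
  shows "l \<in> Cent V f F"
proof -
  have l: "l \<in> V"
    by (rule limitin_closedin[OF lim assms(2)]) (use v in auto)
  have "r_f f l F \<le> rad V f F"
    by (rule r_f_weak_lower_semicontinuous[OF assms(4,3) limitin_imp_weak[OF assms(1) lim] v(2)])
  with l rad_le[OF assms(4) l] show ?thesis by (simp add: Cent_def)
qed

text \<open>Neighbourhoods in (P1) are taken at 0, so convergence is translated there.\<close>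

lemma limitin_diff_limit:
  fixes U :: "'a::real_normed_vector set"
  assumes "\<tau> = euclidean \<or> \<tau> = weak_topology" "limitin \<tau> v l sequentially"
  shows "limitin \<tau> (\<lambda>n. v n - l) 0 sequentially"
  using assms(1)
proof
  assume "\<tau> = euclidean"
  then show ?thesis using assms(2) by (simp add: LIM_zero)
next
  assume "\<tau> = weak_topology"
  then show ?thesis using assms(2)
    by (simp add: limitin_weak_iff blinfun.diff_right LIM_zero)
qed

lemma SACP_imp_property_P1:
  fixes V :: "'a::real_normed_vector set"
  assumes \<tau>: "\<tau> = euclidean \<or> \<tau> = weak_topology" and V: "closedin \<tau> V" "V \<noteq> {}"
    and fin: "\<And>F. F \<in> \<A> \<Longrightarrow> finite F" and S: "SACP \<tau> V \<A>"
  shows "property_P1 \<tau> V \<A>"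
proof -
  have main: "Cent V f F \<noteq> {} \<and> (\<exists>\<delta>>0. delta_Cent \<delta> V f F \<subseteq> {c + w | c w. c \<in> Cent V f F \<and> w \<in> W})"
    if F: "F \<in> \<A>" and f: "convex_monotone_fun F f" and U: "openin \<tau> U" "0 \<in> U" "U \<subseteq> W" for F f U W
  proof
    have sub: "\<exists>r l. strict_mono r \<and> l \<in> Cent V f F \<and> limitin \<tau> (v \<circ> r) l sequentially"
      if v: "\<And>n. v n \<in> V" "(\<lambda>n. r_f f (v n) F) \<longlonglongrightarrow> rad V f F" for v
    proof -
      obtain r l where r: "strict_mono r" "limitin \<tau> (v \<circ> r) l sequentially"
        using S F f v unfolding SACP_def by metis
      moreover have "(\<lambda>n. r_f f ((v \<circ> r) n) F) \<longlonglongrightarrow> rad V f F"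
        using LIMSEQ_subseq_LIMSEQ[OF v(2) r(1)] by (simp add: o_def)
      ultimately have "l \<in> Cent V f F"
        using v(1) by (intro minimizing_limit_in_Cent[OF \<tau> V(1) fin[OF F] f, of "v \<circ> r"]) auto
      with r show ?thesis by blast
    qed
    obtain v where "\<And>n :: nat. v n \<in> V" "(\<lambda>n. r_f f (v n) F) \<longlonglongrightarrow> rad V f F"
      using minimizing_sequence[OF f V(2)] by blast
    from sub[OF this] show "Cent V f F \<noteq> {}" by blast
    show "\<exists>\<delta>>0. delta_Cent \<delta> V f F \<subseteq> {c + w | c w. c \<in> Cent V f F \<and> w \<in> W}" (is "\<exists>\<delta>>0. _ \<subseteq> ?N")
    proof (rule ccontr)
      assume "\<not> ?thesis"
      then have not_sub: "\<not> delta_Cent \<delta> V f F \<subseteq> ?N" if "\<delta> > 0" for \<delta>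
        using that by blast
      \<comment> \<open>The tolerances \<open>1 / (real n + 1)\<close> turn the failure for every
        \<open>\<delta>\<close> into a minimizing sequence outside \<open>?N\<close>.\<close>
      have "\<forall>n. \<exists>x. x \<in> delta_Cent (1 / (real n + 1)) V f F \<and> x \<notin> ?N"
      proof
        fix n
        have "0 < 1 / (real n + 1)" by simp
        from not_sub[OF this] show "\<exists>x. x \<in> delta_Cent (1 / (real n + 1)) V f F \<and> x \<notin> ?N"
          by (simp only: subset_iff not_all not_imp)
      qed
      from choice[OF this] obtain v where v: "\<And>n. v n \<in> delta_Cent (1 / (real n + 1)) V f F" "\<And>n. v n \<notin> ?N"
        by blast
      have vV: "v n \<in> V" "r_f f (v n) F \<le> rad V f F + 1 / (real n + 1)" for n
        using v(1)[of n] by (auto simp: delta_Cent_def)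
      have "(\<lambda>n. r_f f (v n) F) \<longlonglongrightarrow> rad V f F"
        by (rule tendsto_radI[OF f vV])
      from sub[OF vV(1) this] obtain r l where "l \<in> Cent V f F" and lim: "limitin \<tau> (v \<circ> r) l sequentially"
        by blast
      \<comment> \<open>\<open>v (r n)\<close> splits as the center \<open>l\<close> plus the
        difference \<open>v (r n) - l\<close>, which eventually lies in \<open>U\<close>.\<close>
      have "\<forall>\<^sub>F n in sequentially. (v \<circ> r) n - l \<in> U"
        using limitin_diff_limit[OF \<tau> lim] U(1,2) unfolding limitin_def by blast
      then obtain n where "v (r n) - l \<in> U" by (auto simp: eventually_sequentially)
      then have "v (r n) \<in> ?N"
        using \<open>l \<in> Cent V f F\<close> U(3) by (intro CollectI exI[of _ l] exI[of _ "v (r n) - l"]) auto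
      with v(2) show False by blast
    qed
  qed
  show ?thesis
    unfolding property_P1_def
  proof (intro ballI allI impI conjI)
    fix F f assume "F \<in> \<A>" "convex_monotone_fun F f"
    \<comment> \<open>The whole space is taken as the neighbourhood, so that \<open>main\<close>
      also yields nonemptiness.\<close>
    moreover have "openin \<tau> UNIV" using \<tau> by (metis openin_topspace topspace_euclidean topspace_weak_topology)
    ultimately show "Cent V f F \<noteq> {}" using main[of F f UNIV UNIV] by blast
  next
    fix F f W assume "F \<in> \<A>" "convex_monotone_fun F f" "\<exists>U. openin \<tau> U \<and> 0 \<in> U \<and> U \<subseteq> W"
    then show "\<exists>\<delta>>0. delta_Cent \<delta> V f F \<subseteq> {c + w | c w. c \<in> Cent V f F \<and> w \<in> W}"
      using main[of F f _ W] by blast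
  qed
qed

lemma SACP_imp_compactin_Cent:
  fixes V :: "'a::real_normed_vector set"
  assumes \<tau>: "\<tau> = euclidean \<or> \<tau> = weak_topology" and V: "closedin \<tau> V"
    and S: "SACP \<tau> V \<A>" and F: "F \<in> \<A>" "finite F" and f: "convex_monotone_fun F f"
  shows "compactin \<tau> (Cent V f F)"
  unfolding compactin_iff_seq_compactin[OF \<tau>] seq_compactin_def
proof (intro allI impI)
  fix v :: "nat \<Rightarrow> 'a" assume "\<forall>n. v n \<in> Cent V f F"
  then have v: "\<And>n. v n \<in> V" "\<And>n. r_f f (v n) F = rad V f F" by (auto simp: Cent_def)
  \<comment> \<open>\<open>r_f\<close> is constant along a sequence of centers, so the sequence is
    minimizing.\<close>
  then have "(\<lambda>n. r_f f (v n) F) \<longlonglongrightarrow> rad V f F" by simp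
  with v(1) obtain r l where r: "strict_mono r" "limitin \<tau> (v \<circ> r) l sequentially"
    using S F(1) f unfolding SACP_def by metis
  moreover from this have "l \<in> Cent V f F"
    using v by (intro minimizing_limit_in_Cent[OF \<tau> V F(2) f, of "v \<circ> r"]) auto
  ultimately show "\<exists>l\<in>Cent V f F. \<exists>r. strict_mono r \<and> limitin \<tau> (v \<circ> r) l sequentially" by blast
qed

theorem theorem2p2:
  fixes \<tau> :: "'a::banach topology" and V :: "'a set" and \<A> :: "'a set set"
  assumes "\<tau> = euclidean \<or> \<tau> = weak_topology"
    and "closedin \<tau> V"
    and "V \<noteq> {}"
    and "\<forall>F\<in>\<A>. finite F \<and> F \<noteq> {}"
  shows "SACP \<tau> V \<A> \<longleftrightarrow>
           property_P1 \<tau> V \<A> \<and>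
           (\<forall>F\<in>\<A>. \<forall>f. convex_monotone_fun F f \<longrightarrow> compactin \<tau> (Cent V f F))"
proof
  assume "SACP \<tau> V \<A>"
  then show "property_P1 \<tau> V \<A> \<and>
      (\<forall>F\<in>\<A>. \<forall>f. convex_monotone_fun F f \<longrightarrow> compactin \<tau> (Cent V f F))"
    using SACP_imp_property_P1[OF assms(1-3)] SACP_imp_compactin_Cent[OF assms(1,2)] assms(4) by blast
next
  assume R: "property_P1 \<tau> V \<A> \<and>
      (\<forall>F\<in>\<A>. \<forall>f. convex_monotone_fun F f \<longrightarrow> compactin \<tau> (Cent V f F))"
  show "SACP \<tau> V \<A>"
    unfolding SACP_def
  proof (intro ballI allI impI)
    fix F f and v :: "nat \<Rightarrow> 'a" assume F: "F \<in> \<A>"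
      and v: "(\<forall>n. v n \<in> V) \<and> (\<lambda>n. r_f f (v n) F) \<longlonglongrightarrow> rad V f F"
    text \<open>The zero function belongs to the class, and every point of \<open>V\<close> is a center for it.\<close>
    have "convex_monotone_fun F (\<lambda>_. 0)" by (simp add: convex_monotone_fun_def)
    moreover have "Cent V (\<lambda>_. 0) F = V"
      using assms(3) by (simp add: Cent_def r_f_def rad_def)
    ultimately have "compactin \<tau> V" using R F by metis
    then have "seq_compactin \<tau> V" by (simp add: compactin_iff_seq_compactin[OF assms(1)])
    with v show "\<exists>r l. strict_mono r \<and> limitin \<tau> (v \<circ> r) l sequentially"
      unfolding seq_compactin_def by blast
  qed
qed

end
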